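(* Let $D\subseteq\mathbb{C}$ be a simply connected domain and let $\mathcal{F}$ be a family of holomorphic functions on $D$. Then the Julia like set $J(\mathcal{F})$ is connected if and only if the boundary (taken in $D$) of each connected component of the Fatou like set $F(\mathcal{F})$ is connected.
   Context: A family $\mathcal{F}$ of holomorphic functions is normal on an open set if every sequence in $\mathcal{F}$ has a subsequence that converges locally uniformly on that open set either to a holomorphic function or to $\infty$; it is normal at a point if it is normal on some neighborhood of that point. For a family $\mathcal{F}$ of holomorphic functions on a domain $D\subseteq\mathbb{C}$, the Fatou like set $F(\mathcal{F})\subseteq D$ is the set of points of $D$ at which $\mathcal{F}$ is normal, and the Julia like set is $J(\mathcal{F}):=D\setminus F(\mathcal{F})$. For a subset $D_0\subseteq D$, the boundary $\partial D_0$ means the set of boundary points of $D_0$ lying in $D$ (i.e. the boundary relative to $D$). *)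

theory Defs
  imports "HOL-Analysis.Analysis"
begin

definition locally_uniform_limit ::
  "complex set \<Rightarrow> (nat \<Rightarrow> complex \<Rightarrow> complex) \<Rightarrow> (complex \<Rightarrow> complex) \<Rightarrow> bool"
where
  "locally_uniform_limit U f g \<longleftrightarrow>
     (\<forall>z\<in>U. \<exists>V. open V \<and> z \<in> V \<and> V \<subseteq> U \<and> uniform_limit V f g sequentially)"

definition locally_uniform_to_infinity ::
  "complex set \<Rightarrow> (nat \<Rightarrow> complex \<Rightarrow> complex) \<Rightarrow> bool"
where
  "locally_uniform_to_infinity U f \<longleftrightarrow>
     (\<forall>z\<in>U. \<exists>V. open V \<and> z \<in> V \<and> V \<subseteq> U \<and>
        (\<forall>B::real. \<forall>\<^sub>F n in sequentially. \<forall>w\<in>V. B < norm (f n w)))"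

definition normal_family_on :: "(complex \<Rightarrow> complex) set \<Rightarrow> complex set \<Rightarrow> bool"
where
  "normal_family_on \<F> U \<longleftrightarrow>
     (\<forall>f :: nat \<Rightarrow> complex \<Rightarrow> complex. range f \<subseteq> \<F> \<longrightarrow>
        (\<exists>r :: nat \<Rightarrow> nat. strict_mono r \<and>
           ((\<exists>g. g holomorphic_on U \<and> locally_uniform_limit U (f \<circ> r) g) \<or>
            locally_uniform_to_infinity U (f \<circ> r))))"

text \<open>Members of a family on \<open>D\<close> are total functions whose values outside \<open>D\<close> carry no
  meaning, so normality at a point is tested on open neighbourhoods contained in \<open>D\<close>.\<close>

definition fatou_like_set :: "complex set \<Rightarrow> (complex \<Rightarrow> complex) set \<Rightarrow> complex set"
where
  "fatou_like_set D \<F> =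
     {z \<in> D. \<exists>U. open U \<and> z \<in> U \<and> U \<subseteq> D \<and> normal_family_on \<F> U}"

definition julia_like_set :: "complex set \<Rightarrow> (complex \<Rightarrow> complex) set \<Rightarrow> complex set"
where
  "julia_like_set D \<F> = D - fatou_like_set D \<F>"

end

(* Only the topology of D matters: a simply connected plane domain is unicoherent.
   If J is connected, then so is the complement in D of each component C of the Fatou like set F,
   and the boundary of C is the intersection of the connected closed sets D - C and closure of C.
   Conversely, if J splits into two parts and every component of F has connected boundary, then each
   component has its boundary in exactly one of the parts; attaching the components to the parts
   accordingly splits D itself. *)

theory Submission
  imports Defs "HOL-Complex_Analysis.Riemann_Mapping"
begin

text \<open>Links the boundary relative to \<open>D\<close> in the theorem with the ordinary
  frontier that the topological lemmas work with.\<close>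

lemma frontier_of_open_subset:
  assumes "open C" "C \<subseteq> D"
  shows "top_of_set D frontier_of C = D \<inter> frontier C"
proof -
  have "openin (top_of_set D) C"
    using assms by (simp add: open_subset)
  then have "top_of_set D frontier_of C = top_of_set D closure_of C - C"
    by (simp add: frontier_of_def interior_of_openin)
  also have "\<dots> = D \<inter> closure C - C"
    using assms by (simp add: closure_of_subtopology Int_absorb1)
  finally show ?thesis
    using assms by (auto simp: frontier_def interior_open)
qed

text \<open>Components of \<open>U\<close> are open and pairwise disjoint: a frontier point of
  \<open>C\<close> in a component \<open>C'\<close> forces \<open>C'\<close> to meet
  \<open>C\<close>, hence to equal it, but an open set contains none of its frontier points.\<close>

lemma frontier_component_of_open:
  fixes U :: "'a::real_normed_vector set"
  assumes "open U" "C \<in> components U"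
  shows "frontier C \<inter> U = {}"
proof (rule ccontr)
  assume "frontier C \<inter> U \<noteq> {}"
  then obtain p C' where p: "p \<in> frontier C" "p \<in> C'" "C' \<in> components U"
    by (metis Int_emptyI Union_components UnionE)
  have "open C" "open C'"
    using assms p open_components by auto
  moreover have "p \<in> closure C"
    using p by (simp add: frontier_def)
  ultimately have "C \<inter> C' \<noteq> {}"
    using p by (metis IntI disjoint_iff open_Int_closure_eq_empty)
  then have "C = C'"
    using components_eq assms p by blast
  then show False
    using p \<open>open C\<close> by (simp add: frontier_def interior_open)
qed

lemma connected_relative_frontier_component:
  fixes D U :: "'a::real_normed_vector set"
  assumes "connected D" "unicoherent D" "open U" "U \<subseteq> D" "connected (D - U)"
    and C: "C \<in> components U"
  shows "connected (D \<inter> frontier C)"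
proof -
  have sub: "C \<subseteq> D" and "open C" "connected C"
    using C assms in_components_subset open_components in_components_connected by blast+
  \<comment> \<open>\<open>C\<close> is a component of the complement in \<open>D\<close> of the
    connected set \<open>D - U\<close>; removing such a component leaves a connected set.\<close>
  have "connected (D - C)"
    using component_diff_connected [of "D - U" D C] assms by (simp add: double_diff)
  moreover have "connected (D \<inter> closure C)"
    by (rule connected_intermediate_closure [OF \<open>connected C\<close>]) (use sub closure_subset in auto)
  moreover have "D = (D - C) \<union> (D \<inter> closure C)"
    using closure_subset by blast
  moreover have "closedin (top_of_set D) (D - C)"
    using \<open>open C\<close> sub by (simp add: closedin_diff open_subset)
  moreover have "closedin (top_of_set D) (D \<inter> closure C)"
    by (simp add: closedin_closed_Int)
  ultimately have "connected ((D - C) \<inter> (D \<inter> closure C))"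
    using \<open>unicoherent D\<close> unicoherentD by blast
  moreover have "(D - C) \<inter> (D \<inter> closure C) = D \<inter> frontier C"
    using \<open>open C\<close> by (auto simp: frontier_def interior_open)
  ultimately show ?thesis by simp
qed

text \<open>Near a point of \<open>A\<close> outside \<open>U\<close>, a small ball meets only
  components whose frontier meets \<open>A\<close>; by connectedness their whole relative frontier
  lies in \<open>A\<close>, so they are attached. The roles of \<open>A\<close> and \<open>B\<close>
  can be exchanged, so this serves both sides of a separation.\<close>

lemma open_attach_components:
  fixes D U :: "'a::real_normed_vector set"
  assumes "open D" "open U" "U \<subseteq> D" "open A" "open B"
    and cover: "D - U \<subseteq> A \<union> B" and disj: "A \<inter> B \<inter> (D - U) = {}"
    and conn: "\<And>C. C \<in> components U \<Longrightarrow> connected (D \<inter> frontier C)"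
  shows "open ((A \<inter> (D - U)) \<union> \<Union>{C \<in> components U. D \<inter> frontier C \<subseteq> A})" (is "open ?P")
  unfolding open_contains_ball
proof
  fix a assume "a \<in> ?P"
  then consider "a \<in> A" "a \<in> D - U"
    | C where "a \<in> C" "C \<in> components U" "D \<inter> frontier C \<subseteq> A"
    by blast
  then show "\<exists>e>0. ball a e \<subseteq> ?P"
  proof cases
    case 1
    have "open (A \<inter> D)"
      using assms by blast
    then obtain e where "e > 0" and e: "ball a e \<subseteq> A \<inter> D"
      using 1 open_contains_ball by (metis DiffD1 IntI)
    have "y \<in> ?P" if y: "y \<in> ball a e" for y
    proof (cases "y \<in> U")
      case True
      then obtain C where C: "y \<in> C" "C \<in> components U"
        by (metis Union_components UnionE)
      have "a \<notin> C"
        using 1 C in_components_subset by blast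
      \<comment> \<open>The ball is connected and contains \<open>y\<close> in \<open>C\<close> and
        its centre \<open>a\<close> outside \<open>C\<close>, so it crosses the frontier.\<close>
      then have "ball a e \<inter> frontier C \<noteq> {}"
        using y C \<open>e > 0\<close> centre_in_ball [of a e] by (intro connected_Int_frontier connected_ball) blast+
      then have "A \<inter> (D \<inter> frontier C) \<noteq> {}"
        using e by blast
      moreover have "D \<inter> frontier C \<subseteq> D - U"
        using frontier_component_of_open \<open>open U\<close> C by blast
      ultimately have "D \<inter> frontier C \<subseteq> A"
        using connectedD [OF conn [OF C(2)] \<open>open A\<close> \<open>open B\<close>] cover disj by blast
      then show ?thesis
        using C by blast
    qed (use y e in blast)
    then show ?thesis
      using \<open>e > 0\<close> by blast
  next
    case 2
    then show ?thesis
      using open_components [OF \<open>open U\<close>] open_contains_ball [of C] by blast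
  qed
qed

lemma connected_complement_of_frontiers:
  fixes D U :: "'a::real_normed_vector set"
  assumes "open D" "connected D" "open U" "U \<subseteq> D"
    and conn: "\<And>C. C \<in> components U \<Longrightarrow> connected (D \<inter> frontier C)"
  shows "connected (D - U)"
proof (rule ccontr)
  assume "\<not> connected (D - U)"
  then obtain A B where AB: "open A" "open B" and cover: "D - U \<subseteq> A \<union> B"
    and disj: "A \<inter> B \<inter> (D - U) = {}" and ne: "A \<inter> (D - U) \<noteq> {}" "B \<inter> (D - U) \<noteq> {}"
    unfolding connected_def by blast
  \<comment> \<open>\<open>P A\<close> and \<open>P B\<close> will be the separation of
    \<open>D\<close> that contradicts its connectedness.\<close>
  define P where "P X = (X \<inter> (D - U)) \<union> \<Union>{C \<in> components U. D \<inter> frontier C \<subseteq> X}" for X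
  have comp: "C \<subseteq> U" "C \<noteq> {}" "D \<inter> frontier C \<subseteq> D - U" "D \<inter> frontier C \<noteq> {}"
    if C: "C \<in> components U" for C
  proof -
    show "C \<subseteq> U" "C \<noteq> {}"
      using C in_components_subset in_components_nonempty by auto
    show "D \<inter> frontier C \<subseteq> D - U"
      using frontier_component_of_open \<open>open U\<close> C by blast
    \<comment> \<open>By \<open>ne\<close> some point of \<open>D\<close> lies outside
      \<open>U\<close>, hence outside \<open>C\<close>, so the connected set \<open>D\<close>
      crosses the frontier of \<open>C\<close>. An empty relative frontier would put
      \<open>C\<close> into both \<open>P A\<close> and \<open>P B\<close>.\<close>
    show "D \<inter> frontier C \<noteq> {}"
      using \<open>C \<subseteq> U\<close> \<open>C \<noteq> {}\<close> \<open>U \<subseteq> D\<close> ne by (intro connected_Int_frontier \<open>connected D\<close>) auto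
  qed
  have "open (P A)"
    unfolding P_def using open_attach_components [of D U A B] assms AB cover disj by blast
  moreover have "open (P B)"
    unfolding P_def using open_attach_components [of D U B A] assms AB cover disj by blast
  moreover have "D \<subseteq> P A \<union> P B"
  proof
    fix x assume "x \<in> D"
    show "x \<in> P A \<union> P B"
    proof (cases "x \<in> U")
      case True
      then obtain C where C: "x \<in> C" "C \<in> components U"
        by (metis Union_components UnionE)
      then have "D \<inter> frontier C \<subseteq> A \<or> D \<inter> frontier C \<subseteq> B"
        using connectedD [OF conn [OF C(2)] AB] comp(3) cover disj by blast
      then show ?thesis
        using C unfolding P_def by blast
    qed (use \<open>x \<in> D\<close> cover in \<open>auto simp: P_def\<close>)
  qed
  moreover have "P A \<inter> P B = {}"
  proof (rule ccontr)
    assume "P A \<inter> P B \<noteq> {}"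
    then obtain x where x: "x \<in> P A" "x \<in> P B"
      by blast
    show False
    proof (cases "x \<in> U")
      case True
      then obtain C C' where "x \<in> C" "C \<in> components U" "D \<inter> frontier C \<subseteq> A"
        and "x \<in> C'" "C' \<in> components U" "D \<inter> frontier C' \<subseteq> B"
        using x unfolding P_def by blast
      moreover from this have "C = C'"
        using components_eq by blast
      \<comment> \<open>The nonempty relative frontier of \<open>C\<close> would lie in both
        \<open>A\<close> and \<open>B\<close>, which are disjoint on \<open>D - U\<close>.\<close>
      ultimately show False
        using comp(3,4) [of C] disj by blast
    next
      case False
      then show False
        using x disj comp(1) unfolding P_def by blast
    qed
  qed
  moreover have "P A \<inter> D \<noteq> {}" "P B \<inter> D \<noteq> {}"
    using ne unfolding P_def by blast+
  ultimately show False
    using \<open>connected D\<close> unfolding connected_def by blast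
qed

text \<open>A neighbourhood witnessing normality at one point witnesses it at each of its
  points.\<close>

lemma open_fatou_like_set: "open (fatou_like_set D \<F>)"
  by (subst open_subopen) (unfold fatou_like_set_def, blast)

theorem theorem2p9:
  fixes D :: "complex set" and \<F> :: "(complex \<Rightarrow> complex) set"
  assumes "open D" and "connected D" and "D \<noteq> {}" and "simply_connected D"
    and "\<And>f. f \<in> \<F> \<Longrightarrow> f holomorphic_on D"
  shows "connected (julia_like_set D \<F>) \<longleftrightarrow>
    (\<forall>C \<in> components (fatou_like_set D \<F>). connected (top_of_set D frontier_of C))"
proof -
  let ?U = "fatou_like_set D \<F>"
  have U: "open ?U" "?U \<subseteq> D"
    by (simp_all add: open_fatou_like_set) (auto simp: fatou_like_set_def)
  \<comment> \<open>An open simply connected plane set is Borsukian: every continuous map from it to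
    the punctured plane is null-homotopic. This yields unicoherence.\<close>
  have "unicoherent D"
    using assms simply_connected_eq_Borsukian Borsukian_imp_unicoherent by blast
  then have "connected (D - ?U) \<longleftrightarrow> (\<forall>C \<in> components ?U. connected (D \<inter> frontier C))"
    using assms U connected_relative_frontier_component connected_complement_of_frontiers by metis
  moreover have "top_of_set D frontier_of C = D \<inter> frontier C" if "C \<in> components ?U" for C
    using that U frontier_of_open_subset open_components in_components_subset
    by (metis subset_trans)
  ultimately show ?thesis
    by (simp add: julia_like_set_def)
qed

end
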